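(* For all $n\ge 2t-1$ with $t\ge 2$ and $r<t$, $$\operatorname{sat}_{S_r}(n,S_t)=\min_{0\le m\le t-1} s_r(\mathrm{KR}_{t,n}(m)).$$ Note also that $$s_r(\mathrm{KR}_{t,n}(m))=\begin{cases} m\binom{m-1}{r}+(n-m)\binom{t-1}{r} & \text{if } (t-1)(n-m)\text{ is even},\\ m\binom{m-1}{r}+(n-m)\binom{t-1}{r}+\binom{m-1}{r-1} & \text{if } (t-1)(n-m)\text{ is odd.}\end{cases}$$
   Context: $S_r=K_{1,r}$ is the star with $r$ edges and $r+1$ vertices. A graph $G$ is $F$-saturated if it contains no copy of $F$ as a (not necessarily induced) subgraph, but the addition of any missing edge creates at least one copy of $F$. $s_r(G)$ denotes the number of copies of $S_r$ in $G$, and $\operatorname{sat}_{S_r}(n,S_t)$ denotes the minimum number of copies of $S_r$ in an $S_t$-saturated graph on $n$ vertices. Given $a<b$, $R_{a,b}$ denotes a graph on $b$ vertices that is as close to $a$-regular as possible: when $ab$ is even, $R_{a,b}$ is $a$-regular; when $ab$ is odd, $R_{a,b}$ has one vertex of degree $a-1$ and $b-1$ vertices of degree $a$. For $m\le t-1$, $\mathrm{KR}_{t,n}(m)$ is the disjoint union $K_m\cup R_{t-1,n-m}$ if $(t-1)(n-m)$ is even, and it is $K_m\cup R_{t-1,n-m}+e$ if $(t-1)(n-m)$ is odd, where $e$ is an edge between the vertex of degree $t-2$ in $R_{t-1,n-m}$ and an arbitrary vertex of the clique $K_m$.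
   Formalization: For r=1 the printed formula counts each edge twice, so it is stated for 2·s_1. If m=0 and (t-1)n is odd, the edge e has no clique end: KR_{t,n}(0) is taken to be R_{t-1,n} and the formula is not claimed. The formula is stated only for r≥1. *)

theory Defs
  imports Main
begin

text \<open>Finite simple graphs: a vertex set together with a set of two-element subsets of it.\<close>

type_synonym 'a graph = "'a set \<times> 'a set set"

abbreviation verts :: "'a graph \<Rightarrow> 'a set" where "verts \<equiv> fst"

abbreviation edges :: "'a graph \<Rightarrow> 'a set set" where "edges \<equiv> snd"

definition simple_graph :: "'a graph \<Rightarrow> bool" where
  "simple_graph G \<longleftrightarrow> finite (verts G) \<and> (\<forall>e\<in>edges G. e \<subseteq> verts G \<and> card e = 2)"

definition degree :: "'a graph \<Rightarrow> 'a \<Rightarrow> nat" where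
  "degree G v = card {e \<in> edges G. v \<in> e}"

definition subgraph :: "'a graph \<Rightarrow> 'a graph \<Rightarrow> bool" where
  "subgraph H G \<longleftrightarrow> simple_graph H \<and> verts H \<subseteq> verts G \<and> edges H \<subseteq> edges G"

definition graph_iso :: "'a graph \<Rightarrow> 'b graph \<Rightarrow> bool" where
  "graph_iso G H \<longleftrightarrow>
     (\<exists>f. bij_betw f (verts G) (verts H) \<and> (\<lambda>e. f ` e) ` edges G = edges H)"

definition copies :: "'a graph \<Rightarrow> 'b graph \<Rightarrow> 'b graph set" where
  "copies F G = {H. subgraph H G \<and> graph_iso F H}"

definition add_edge :: "'a graph \<Rightarrow> 'a \<Rightarrow> 'a \<Rightarrow> 'a graph" where
  "add_edge G u v = (verts G, insert {u, v} (edges G))"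

definition saturated :: "'a graph \<Rightarrow> 'b graph \<Rightarrow> bool" where
  "saturated F G \<longleftrightarrow> simple_graph G \<and> copies F G = {} \<and>
     (\<forall>u\<in>verts G. \<forall>v\<in>verts G. u \<noteq> v \<and> {u, v} \<notin> edges G \<longrightarrow> copies F (add_edge G u v) \<noteq> {})"

text \<open>Taking vertices in \<^typ>\<open>nat\<close> loses no generality, since every finite graph is isomorphic
  to one on natural numbers.\<close>

definition gen_sat :: "'a graph \<Rightarrow> nat \<Rightarrow> 'b graph \<Rightarrow> nat" where
  "gen_sat H n F =
     (LEAST k. \<exists>G :: nat graph. saturated F G \<and> card (verts G) = n \<and> card (copies H G) = k)"

definition star :: "nat \<Rightarrow> nat graph" where
  "star r = ({0..r}, {{0, i} |i. i \<in> {1..r}})"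

text \<open>Copies are subgraphs, so for \<open>r \<ge> 2\<close> their number is the sum of \<open>degree G v choose r\<close>
  over all vertices, whereas for \<open>r = 1\<close> that sum counts every edge twice, once per endpoint.\<close>

definition star_count :: "nat \<Rightarrow> 'a graph \<Rightarrow> nat" where
  "star_count r G = card (copies (star r) G)"

definition complete_graph :: "'a set \<Rightarrow> 'a graph" where
  "complete_graph A = (A, {e. e \<subseteq> A \<and> card e = 2})"

definition graph_union :: "'a graph \<Rightarrow> 'a graph \<Rightarrow> 'a graph" where
  "graph_union G H = (verts G \<union> verts H, edges G \<union> edges H)"

text \<open>The graphs \<open>R\<^bsub>a,b\<^esub>\<close> and \<open>KR\<^bsub>t,n\<^esub>(m)\<close> are not determined up to isomorphism by their
  description, so they are rendered as predicates.\<close>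

definition is_R :: "nat \<Rightarrow> nat \<Rightarrow> 'a graph \<Rightarrow> bool" where
  "is_R a b G \<longleftrightarrow> simple_graph G \<and> a < b \<and> card (verts G) = b \<and>
     (if even (a * b) then \<forall>v\<in>verts G. degree G v = a
      else \<exists>w\<in>verts G. degree G w = a - 1 \<and> (\<forall>v\<in>verts G - {w}. degree G v = a))"

text \<open>If \<open>(t - 1)(n - m)\<close> is odd and \<open>m = 0\<close>, the clique has no vertex to which the extra
  edge could be attached; in this case \<open>KR\<^bsub>t,n\<^esub>(0)\<close> is taken to be \<open>R\<^bsub>t-1,n\<^esub>\<close> itself.\<close>

definition is_KR :: "nat \<Rightarrow> nat \<Rightarrow> nat \<Rightarrow> 'a graph \<Rightarrow> bool" where
  "is_KR t n m G \<longleftrightarrow>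
     (\<exists>A R. finite A \<and> card A = m \<and> is_R (t - 1) (n - m) R \<and> A \<inter> verts R = {} \<and>
        (if even ((t - 1) * (n - m)) \<or> m = 0
         then G = graph_union (complete_graph A) R
         else \<exists>w\<in>verts R. \<exists>x\<in>A. degree R w = t - 2 \<and>
                G = add_edge (graph_union (complete_graph A) R) w x))"

end

theory Submission
  imports Defs
begin

text \<open>
  Two facts about degrees drive the proof. For \<open>r \<ge> 2\<close> a copy of \<open>S\<^sub>r\<close> is a centre together
  with \<open>r\<close> of its neighbours, so the number of copies is the sum of \<open>degree G v choose r\<close>; for
  \<open>r = 1\<close> the same sum is twice the number of copies (\<open>star_count_degree_sum\<close>). (For \<open>r = 0\<close> every
  graph on \<open>n\<close> vertices has \<open>n\<close> copies, and the claimed equality reads \<open>n = n\<close>.) And a graph is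
  \<open>S\<^sub>t\<close>-saturated exactly when all degrees are at most \<open>t - 1\<close> and the vertices of smaller
  degree form a clique (\<open>saturated_star_iff\<close>), because a new edge raises only the degrees of
  its two ends.

  The graphs \<open>KR\<^bsub>t,n\<^esub>(m)\<close> meet this criterion, which bounds the saturation number from above.
  Conversely, let \<open>G\<close> be saturated with \<open>m\<close> vertices of degree below \<open>t - 1\<close>. They form a
  clique, so \<open>m \<le> t - 1\<close> and each of them has degree at least \<open>m - 1\<close>; all other degrees
  equal \<open>t - 1\<close>. If \<open>(t - 1)(n - m)\<close> is odd, not all of the \<open>m\<close> degrees can equal \<open>m - 1\<close>,
  since the degree sum \<open>m(m - 1) + (t - 1)(n - m)\<close> would be odd; so one of them is at least
  \<open>m\<close>. Hence the degree sequence of \<open>G\<close> dominates that of \<open>KR\<^bsub>t,n\<^esub>(m)\<close>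
  (\<open>saturated_degree_sum_ge\<close>). The same parity argument excludes \<open>m = 0\<close> when \<open>(t - 1)n\<close> is
  odd, which is the one case where \<open>KR\<^bsub>t,n\<^esub>(m)\<close> has a vertex outside its clique of degree below
  \<open>t - 1\<close>.

  The graphs \<open>R\<^bsub>a,b\<^esub>\<close> are realised by circulant graphs, with an additional near-perfect
  matching when \<open>a\<close> and \<open>b\<close> are both odd (\<open>is_R_exists\<close>).
\<close>

section \<open>Degrees and neighbourhoods\<close>

definition nbrs :: "'a graph \<Rightarrow> 'a \<Rightarrow> 'a set" where
  "nbrs G v = {u. {v, u} \<in> edges G}"

lemma nbrs_subset: "simple_graph G \<Longrightarrow> nbrs G v \<subseteq> verts G - {v}"
  by (fastforce simp: nbrs_def simple_graph_def)

lemma finite_nbrs: "simple_graph G \<Longrightarrow> finite (nbrs G v)"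
  by (meson finite_Diff finite_subset nbrs_subset simple_graph_def)

lemma finite_edges: "simple_graph G \<Longrightarrow> finite (edges G)"
  by (rule finite_subset[of _ "Pow (verts G)"]) (auto simp: simple_graph_def)

lemma degree_eq_card_nbrs:
  assumes "simple_graph G"
  shows "degree G v = card (nbrs G v)"
proof -
  have "{e \<in> edges G. v \<in> e} = (\<lambda>u. {v, u}) ` nbrs G v"
  proof (intro equalityI subsetI)
    fix e assume e: "e \<in> {e \<in> edges G. v \<in> e}"
    then have "card e = 2" using assms by (auto simp: simple_graph_def)
    then obtain u where "e = {v, u}" using e by (auto simp: card_2_iff)
    then show "e \<in> (\<lambda>u. {v, u}) ` nbrs G v" using e by (auto simp: nbrs_def)
  qed (auto simp: nbrs_def)
  moreover have "inj_on (\<lambda>u. {v, u}) (nbrs G v)"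
    by (auto simp: inj_on_def doubleton_eq_iff)
  ultimately show ?thesis by (simp add: degree_def card_image)
qed

lemma degree_outside:
  assumes "simple_graph G" "v \<notin> verts G"
  shows "degree G v = 0"
proof -
  have "{e \<in> edges G. v \<in> e} = {}" using assms by (auto simp: simple_graph_def)
  then show ?thesis by (simp only: degree_def card.empty)
qed

text \<open>Both ends of each edge contribute one to the degree sum.\<close>

lemma handshake:
  assumes "simple_graph G"
  shows "(\<Sum>v\<in>verts G. degree G v) = 2 * card (edges G)"
proof -
  have "{v \<in> verts G. v \<in> e} = e" if "e \<in> edges G" for e
    using assms that by (auto simp: simple_graph_def)
  then have "\<forall>e\<in>edges G. card {v \<in> verts G. v \<in> e} = 2"
    using assms by (auto simp: simple_graph_def)
  then show ?thesis
    unfolding degree_def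
    using assms by (intro sum_multicount) (auto simp: finite_edges simple_graph_def)
qed

lemma simple_graph_union:
  "simple_graph G \<Longrightarrow> simple_graph H \<Longrightarrow> simple_graph (graph_union G H)"
  by (auto simp: simple_graph_def graph_union_def)

lemma degree_graph_union:
  assumes "simple_graph G" "simple_graph H" "edges G \<inter> edges H = {}"
  shows "degree (graph_union G H) v = degree G v + degree H v"
proof -
  have "{e \<in> edges (graph_union G H). v \<in> e} = {e \<in> edges G. v \<in> e} \<union> {e \<in> edges H. v \<in> e}"
    by (auto simp: graph_union_def)
  moreover have "{e \<in> edges G. v \<in> e} \<inter> {e \<in> edges H. v \<in> e} = {}"
    using assms(3) by blast
  ultimately show ?thesis
    using assms(1,2) by (simp add: degree_def finite_edges card_Un_disjoint)
qed

lemma simple_graph_add_edge: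
  "simple_graph G \<Longrightarrow> u \<in> verts G \<Longrightarrow> w \<in> verts G \<Longrightarrow> u \<noteq> w \<Longrightarrow> simple_graph (add_edge G u w)"
  by (auto simp: simple_graph_def add_edge_def)

lemma degree_add_edge:
  assumes "simple_graph G" "{u, w} \<notin> edges G"
  shows "degree (add_edge G u w) v = degree G v + (if v = u \<or> v = w then 1 else 0)"
proof -
  have "{e \<in> edges (add_edge G u w). v \<in> e} =
    (if v = u \<or> v = w then insert {u, w} {e \<in> edges G. v \<in> e} else {e \<in> edges G. v \<in> e})"
    by (auto simp: add_edge_def)
  then show ?thesis
    using assms by (simp add: degree_def finite_edges)
qed

lemma simple_graph_complete: "finite A \<Longrightarrow> simple_graph (complete_graph A)"
  by (auto simp: simple_graph_def complete_graph_def)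

lemma degree_complete:
  assumes "finite A" "v \<in> A"
  shows "degree (complete_graph A) v = card A - 1"
proof -
  have "nbrs (complete_graph A) v = A - {v}"
    using assms by (auto simp: nbrs_def complete_graph_def card_insert_if split: if_splits)
  then show ?thesis
    using assms by (simp add: degree_eq_card_nbrs simple_graph_complete)
qed

section \<open>Counting stars\<close>

definition star_at :: "'a \<Rightarrow> 'a set \<Rightarrow> 'a graph" where
  "star_at c L = (insert c L, (\<lambda>l. {c, l}) ` L)"

lemma star_eq_star_at: "star r = star_at 0 {1..r}"
  by (auto simp: star_def star_at_def)

text \<open>An isomorphism \<open>f\<close> from \<open>S\<^sub>r\<close> has as its image the star with centre \<open>f 0\<close> and leaves
  \<open>f ` {1..r}\<close>; conversely, any numbering of \<open>r\<close> neighbours of a vertex gives such an \<open>f\<close>.\<close>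

lemma copies_star:
  assumes G: "simple_graph G"
  shows "copies (star r) G =
    (\<lambda>(c, L). star_at c L) ` (SIGMA c:verts G. {L. L \<subseteq> nbrs G c \<and> card L = r})"
    (is "_ = ?S")
proof (intro equalityI subsetI)
  fix H assume "H \<in> copies (star r) G"
  then obtain f where sub: "subgraph H G" and bij: "bij_betw f (insert 0 {1..r}) (verts H)"
    and img: "(\<lambda>e. f ` e) ` (\<lambda>l. {0, l}) ` {1..r} = edges H"
    by (auto simp: copies_def graph_iso_def star_eq_star_at star_at_def)
  have H: "H = star_at (f 0) (f ` {1..r})"
  proof (rule prod_eqI)
    show "verts H = verts (star_at (f 0) (f ` {1..r}))"
      using bij by (simp add: star_at_def bij_betw_def)
    show "edges H = edges (star_at (f 0) (f ` {1..r}))"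
      unfolding img[symmetric] star_at_def by (simp add: image_image)
  qed
  moreover have "card (f ` {1..r}) = r"
    using card_image[of f "{1..r}"] bij by (simp add: bij_betw_def)
  moreover have "f 0 \<in> verts G" "f ` {1..r} \<subseteq> nbrs G (f 0)"
    using sub H by (auto simp: subgraph_def star_at_def nbrs_def)
  ultimately show "H \<in> ?S" by auto
next
  fix H assume "H \<in> ?S"
  then obtain c L where H: "H = star_at c L" and c: "c \<in> verts G" and L: "L \<subseteq> nbrs G c"
    and card: "card L = r" by auto
  have fin: "finite L" using L finite_nbrs[OF G] finite_subset by blast
  have LG: "L \<subseteq> verts G - {c}" using L nbrs_subset[OF G] by blast
  obtain h where h: "bij_betw h {1..r} L"
    using ex_bij_betw_nat_finite_1[OF fin] card by auto
  define f where "f = h(0 := c)"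
  have fh: "f i = h i" if "i \<in> {1..r}" for i using that by (auto simp: f_def)
  have fL: "bij_betw f {1..r} L"
    using h bij_betw_cong[of "{1..r}" f h L] fh by blast
  have "bij_betw f (insert 0 {1..r}) (insert c L)"
    using fL LG bij_betw_combine[of f "{0}" "{c}" "{1..r}" L]
    by (auto simp: bij_betw_def f_def)
  moreover have "(\<lambda>e. f ` e) ` (\<lambda>l. {0, l}) ` {1..r} = (\<lambda>l. {c, l}) ` L"
  proof -
    have "(\<lambda>e. f ` e) ` (\<lambda>l. {0, l}) ` {1..r} = (\<lambda>l. {c, l}) ` f ` {1..r}"
      by (simp add: image_image) (simp add: f_def)
    then show ?thesis using fL by (simp add: bij_betw_def)
  qed
  ultimately have "graph_iso (star r) H"
    unfolding graph_iso_def star_eq_star_at H star_at_def by auto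
  moreover have two: "card {c, l} = 2" if "l \<in> L" for l
  proof -
    have "c \<noteq> l" using that LG by blast
    then show ?thesis by simp
  qed
  have "subgraph H G"
    using c L LG fin two by (auto simp: subgraph_def simple_graph_def H star_at_def nbrs_def)
  ultimately show "H \<in> copies (star r) G" by (simp add: copies_def)
qed

lemma star_count_0:
  assumes "simple_graph G"
  shows "star_count 0 G = card (verts G)"
proof -
  have "{L. L \<subseteq> nbrs G c \<and> card L = 0} = {{}}" for c
    using finite_nbrs[OF assms, of c] by (auto dest: finite_subset)
  then have "(SIGMA c:verts G. {L. L \<subseteq> nbrs G c \<and> card L = 0}) = (\<lambda>c. (c, {})) ` verts G"
    by (simp only:) auto
  then have "copies (star 0) G = (\<lambda>c. ({c}, {})) ` verts G"
    unfolding copies_star[OF assms] by (simp add: image_image star_at_def)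
  then show ?thesis
    unfolding star_count_def by (simp add: card_image inj_on_def)
qed

lemma star_count_1:
  assumes "simple_graph G"
  shows "star_count 1 G = card (edges G)"
proof -
  have "copies (star 1) G = (\<lambda>e. (e, {e})) ` edges G"
  proof (intro equalityI subsetI)
    fix H assume "H \<in> copies (star 1) G"
    then obtain c l where "H = star_at c {l}" "{c, l} \<in> edges G"
      unfolding copies_star[OF assms] by (auto simp: card_1_singleton_iff nbrs_def)
    then show "H \<in> (\<lambda>e. (e, {e})) ` edges G"
      by (auto simp: star_at_def)
  next
    fix H assume "H \<in> (\<lambda>e. (e, {e})) ` edges G"
    then obtain e where e: "e \<in> edges G" "H = (e, {e})" by auto
    then obtain c l where cl: "e = {c, l}"
      using assms by (auto simp: simple_graph_def card_2_iff)
    then have "c \<in> verts G" "H = star_at c {l}" "l \<in> nbrs G c"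
      using e assms by (auto simp: simple_graph_def star_at_def nbrs_def)
    then show "H \<in> copies (star 1) G"
      unfolding copies_star[OF assms] by force
  qed
  then show ?thesis
    unfolding star_count_def by (simp add: card_image inj_on_def)
qed

text \<open>A star with two or more leaves determines its centre, the common point of its edges.\<close>

lemma star_at_inject:
  assumes "star_at c L = star_at c' L'" and "card L \<ge> 2" and "c \<notin> L" and "c' \<notin> L'"
  shows "c = c' \<and> L = L'"
proof -
  have E: "(\<lambda>l. {c, l}) ` L = (\<lambda>l. {c', l}) ` L'" and V: "insert c L = insert c' L'"
    using assms(1) by (auto simp: star_at_def)
  have "c = c'"
  proof (rule ccontr)
    assume "c \<noteq> c'"
    have "l = c'" if "l \<in> L" for l
    proof -
      have "{c, l} \<in> (\<lambda>l. {c', l}) ` L'" using that E by blast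
      then show ?thesis using \<open>c \<noteq> c'\<close> by auto
    qed
    then have "L \<subseteq> {c'}" by blast
    then show False using card_mono[of "{c'}" L] assms(2) by simp
  qed
  then show ?thesis using V assms(3,4) by auto
qed

lemma star_count_ge_2:
  assumes G: "simple_graph G" and r: "r \<ge> 2"
  shows "star_count r G = (\<Sum>v\<in>verts G. degree G v choose r)"
proof -
  let ?S = "SIGMA c:verts G. {L. L \<subseteq> nbrs G c \<and> card L = r}"
  have inj: "inj_on (\<lambda>(c, L). star_at c L) ?S"
  proof (rule inj_onI, clarify)
    fix c L c' L'
    assume eq: "star_at c L = star_at c' L'" and "L \<subseteq> nbrs G c" "L' \<subseteq> nbrs G c'" "r = card L"
    then have "c \<notin> L" "c' \<notin> L'" using nbrs_subset[OF G] by blast+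
    then show "c = c' \<and> L = L'"
      using star_at_inject[OF eq] r \<open>r = card L\<close> by simp
  qed
  have "star_count r G = card ?S"
    unfolding star_count_def copies_star[OF G] by (rule card_image[OF inj])
  also have "\<dots> = (\<Sum>v\<in>verts G. card {L. L \<subseteq> nbrs G v \<and> card L = r})"
    using G finite_nbrs[OF G] by (intro card_SigmaI) (auto simp: simple_graph_def)
  also have "\<dots> = (\<Sum>v\<in>verts G. degree G v choose r)"
    by (simp add: n_subsets finite_nbrs[OF G] degree_eq_card_nbrs[OF G])
  finally show ?thesis .
qed

lemma star_count_degree_sum:
  assumes "simple_graph G" and "r \<ge> 1"
  shows "(if r = 1 then 2 else 1) * star_count r G = (\<Sum>v\<in>verts G. degree G v choose r)"
  using assms handshake[OF assms(1)] star_count_1[OF assms(1)] star_count_ge_2[OF assms(1), of r]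
  by auto

section \<open>Saturation for stars\<close>

lemma copies_star_empty_iff:
  assumes "simple_graph G"
  shows "copies (star t) G = {} \<longleftrightarrow> (\<forall>v\<in>verts G. degree G v < t)"
proof -
  have "(\<exists>L. L \<subseteq> nbrs G v \<and> card L = t) \<longleftrightarrow> t \<le> degree G v" for v
    unfolding degree_eq_card_nbrs[OF assms]
    by (metis card_mono finite_nbrs[OF assms] obtain_subset_with_card_n)
  then show ?thesis
    unfolding copies_star[OF assms] by (auto simp: not_le[symmetric])
qed

text \<open>A new edge \<open>uv\<close> creates a vertex of degree \<open>t\<close> exactly when \<open>u\<close> or \<open>v\<close> already has the
  largest possible degree \<open>t - 1\<close>; so two vertices that are both below it have to be adjacent.\<close>

lemma saturated_star_iff:
  fixes G :: "'a graph"
  shows "saturated (star t) G \<longleftrightarrow> simple_graph G \<and> (\<forall>v\<in>verts G. degree G v < t) \<and>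
    (\<forall>u\<in>verts G. \<forall>v\<in>verts G.
       u \<noteq> v \<and> degree G u < t - 1 \<and> degree G v < t - 1 \<longrightarrow> {u, v} \<in> edges G)"
proof -
  have "copies (star t) (add_edge G u v) \<noteq> {} \<longleftrightarrow> \<not> (degree G u < t - 1 \<and> degree G v < t - 1)"
    if G: "simple_graph G" and deg: "\<forall>v\<in>verts G. degree G v < t"
      and uv: "u \<in> verts G" "v \<in> verts G" "u \<noteq> v" "{u, v} \<notin> edges G" for u v
  proof -
    have "verts (add_edge G u v) = verts G" by (simp add: add_edge_def)
    then have "copies (star t) (add_edge G u v) = {} \<longleftrightarrow>
        (\<forall>x\<in>verts G. degree G x + (if x = u \<or> x = v then 1 else 0) < t)"
      using copies_star_empty_iff[OF simple_graph_add_edge[OF G uv(1-3)]] degree_add_edge[OF G uv(4)]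
      by auto
    also have "\<dots> \<longleftrightarrow> degree G u < t - 1 \<and> degree G v < t - 1"
      using deg uv by (auto simp: less_diff_conv)
    finally show ?thesis by simp
  qed
  then show ?thesis
    unfolding saturated_def using copies_star_empty_iff[of G t] by meson
qed

section \<open>Almost regular graphs\<close>

text \<open>When \<open>D\<close> is closed under \<open>d \<mapsto> b - d\<close>, this is the circulant graph on the residues modulo
  \<open>b\<close> with connection set \<open>D\<close>; comparing \<open>i < j\<close> avoids modular arithmetic.\<close>

definition circulant :: "nat \<Rightarrow> nat set \<Rightarrow> nat graph" where
  "circulant b D = ({0..<b}, {{i, j} |i j. i < j \<and> j < b \<and> j - i \<in> D})"

lemma simple_graph_circulant: "simple_graph (circulant b D)"
  by (auto simp: simple_graph_def circulant_def)

lemma mem_edges_circulant: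
  "i < j \<Longrightarrow> {i, j} \<in> edges (circulant b D) \<longleftrightarrow> j < b \<and> j - i \<in> D"
  by (auto simp: circulant_def doubleton_eq_iff)

text \<open>Each \<open>d \<in> D\<close> leads from \<open>v\<close> to the neighbour \<open>v - d\<close> modulo \<open>b\<close>; the symmetry of \<open>D\<close>
  ensures that the neighbours above \<open>v\<close> are obtained by wrapping around.\<close>

lemma degree_circulant:
  assumes D: "D \<subseteq> {1..<b}" and sym: "\<And>d. d \<in> D \<Longrightarrow> b - d \<in> D" and v: "v < b"
  shows "degree (circulant b D) v = card D"
proof -
  let ?f = "\<lambda>d. if d \<le> v then v - d else v + (b - d)"
  have nb: "u \<in> nbrs (circulant b D) v \<longleftrightarrow>
      (u < v \<and> v - u \<in> D) \<or> (v < u \<and> u < b \<and> u - v \<in> D)" for u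
  proof (cases u v rule: linorder_cases)
    case less
    then have "{v, u} = {u, v}" by auto
    then show ?thesis using less v mem_edges_circulant[of u v b D] by (simp add: nbrs_def)
  next
    case equal
    then show ?thesis by (auto simp: nbrs_def circulant_def)
  next
    case greater
    then show ?thesis using mem_edges_circulant[of v u b D] by (simp add: nbrs_def)
  qed
  have "nbrs (circulant b D) v = ?f ` D"
  proof (intro equalityI subsetI)
    fix u assume "u \<in> nbrs (circulant b D) v"
    then consider "u < v" "v - u \<in> D" | "v < u" "u < b" "u - v \<in> D" using nb by blast
    then show "u \<in> ?f ` D"
    proof cases
      case 1
      then show ?thesis by (intro image_eqI[where x = "v - u"]) auto
    next
      case 2
      then show ?thesis using sym[of "u - v"] by (intro image_eqI[where x = "b - (u - v)"]) auto
    qed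
  next
    fix u assume "u \<in> ?f ` D"
    then obtain d where d: "d \<in> D" "u = ?f d" by blast
    have "1 \<le> d" "d < b" "b - d \<in> D" using D sym[OF d(1)] d(1) by auto
    then show "u \<in> nbrs (circulant b D) v"
      unfolding nb using d v by (cases "d \<le> v") auto
  qed
  moreover have "inj_on ?f D"
  proof (rule inj_onI)
    fix d d' assume dd: "d \<in> D" "d' \<in> D" and eq: "?f d = ?f d'"
    have "1 \<le> d" "d < b" "1 \<le> d'" "d' < b" using dd D by auto
    then show "d = d'" using eq by (cases "d \<le> v"; cases "d' \<le> v") auto
  qed
  ultimately show ?thesis
    unfolding degree_eq_card_nbrs[OF simple_graph_circulant] by (simp only: card_image)
qed

definition consecutive_matching :: "nat \<Rightarrow> nat graph" where
  "consecutive_matching b = ({0..<b}, {{2 * i, 2 * i + 1} |i. 2 * i + 1 < b})"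

lemma simple_graph_consecutive_matching: "simple_graph (consecutive_matching b)"
  by (auto simp: simple_graph_def consecutive_matching_def)

lemma degree_consecutive_matching:
  assumes "odd b" "v < b"
  shows "degree (consecutive_matching b) v = (if v = b - 1 then 0 else 1)"
proof -
  have nb: "u \<in> nbrs (consecutive_matching b) v \<longleftrightarrow>
      (\<exists>i. 2 * i + 1 < b \<and> (v = 2 * i \<and> u = 2 * i + 1 \<or> v = 2 * i + 1 \<and> u = 2 * i))" for u
    by (auto simp: nbrs_def consecutive_matching_def doubleton_eq_iff)
  have "nbrs (consecutive_matching b) v =
    (if v = b - 1 then {} else if even v then {v + 1} else {v - 1})" (is "_ = ?N")
  proof (intro set_eqI)
    fix u
    show "u \<in> nbrs (consecutive_matching b) v \<longleftrightarrow> u \<in> ?N"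
    proof (cases "even v")
      case True
      then obtain j where j: "v = 2 * j" by (rule evenE)
      have "2 * j \<noteq> Suc (2 * i)" for i by presburger
      then have "u \<in> nbrs (consecutive_matching b) v \<longleftrightarrow> v + 1 < b \<and> u = v + 1"
        unfolding nb by (auto simp: j)
      then show ?thesis using True assms(2) by auto
    next
      case False
      then obtain j where j: "v = 2 * j + 1" by (rule oddE)
      have "Suc (2 * j) \<noteq> 2 * i" for i by presburger
      then have "u \<in> nbrs (consecutive_matching b) v \<longleftrightarrow> u = v - 1"
        unfolding nb using assms(2) j by auto
      moreover have "v \<noteq> b - 1" using False assms by auto
      ultimately show ?thesis using False by simp
    qed
  qed
  then show ?thesis
    by (simp add: degree_eq_card_nbrs simple_graph_consecutive_matching)
qed

lemma is_R_exists:
  assumes "a < b"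
  shows "\<exists>R. is_R a b R \<and> verts R = {0..<b}"
proof -
  have verts: "verts (circulant b D) = {0..<b}" for D by (simp add: circulant_def)
  have reg: ?thesis
    if "even (a * b)" "D \<subseteq> {1..<b}" "\<And>d. d \<in> D \<Longrightarrow> b - d \<in> D" "card D = a" for D
    using that assms simple_graph_circulant[of b D] degree_circulant[of D b] verts[of D]
    by (intro exI[of _ "circulant b D"]) (auto simp: is_R_def)
  consider k where "a = 2 * k"
    | k c where "a = 2 * k + 1" "b = 2 * c"
    | k where "a = 2 * k + 1" "odd b"
    by (metis evenE oddE)
  then show ?thesis
  proof cases
    case 1
    have "card ({1..k} \<union> {b - k..<b}) = a"
      using 1 assms by (subst card_Un_disjoint) auto
    then show ?thesis
      using 1 assms by (intro reg[of "{1..k} \<union> {b - k..<b}"]) auto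
  next
    case 2
    have "card ({1..k} \<union> {b - k..<b}) = 2 * k"
      using 2 assms by (subst card_Un_disjoint) auto
    then have "card (insert c ({1..k} \<union> {b - k..<b})) = a"
      using 2 assms by (subst card_insert_disjoint) auto
    then show ?thesis
      using 2 assms by (intro reg[of "insert c ({1..k} \<union> {b - k..<b})"]) auto
  next
    case 3
    then have kb: "2 * k + 3 \<le> b" using assms by (auto elim!: oddE)
    \<comment> \<open>The differences \<open>1\<close> and \<open>b - 1\<close> are left out, so that the circulant graph contains no
      edge \<open>{2i, 2i + 1}\<close> of the matching.\<close>
    define D where "D = {2..k + 1} \<union> {b - k - 1..<b - 1}"
    have "card D = 2 * k" unfolding D_def using kb by (subst card_Un_disjoint) auto
    moreover have "D \<subseteq> {1..<b}" using kb by (auto simp: D_def)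
    moreover have "b - d \<in> D" if "d \<in> D" for d using that kb by (auto simp: D_def)
    ultimately have deg: "degree (circulant b D) v = 2 * k" if "v < b" for v
      using degree_circulant[of D b v] that by simp
    have "edges (circulant b D) \<inter> edges (consecutive_matching b) = {}"
    proof (rule ccontr)
      assume "edges (circulant b D) \<inter> edges (consecutive_matching b) \<noteq> {}"
      then obtain i where "{2 * i, 2 * i + 1} \<in> edges (circulant b D)"
        by (auto simp: consecutive_matching_def)
      then have "1 \<in> D" using mem_edges_circulant[of "2 * i" "2 * i + 1" b D] by simp
      then show False using kb by (auto simp: D_def)
    qed
    then have "degree (graph_union (circulant b D) (consecutive_matching b)) v =
        (if v = b - 1 then a - 1 else a)" if "v < b" for v
      using degree_graph_union[OF simple_graph_circulant simple_graph_consecutive_matching] deg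
        degree_consecutive_matching[of b v] that 3 by auto
    moreover have "verts (graph_union (circulant b D) (consecutive_matching b)) = {0..<b}"
      by (simp add: graph_union_def circulant_def consecutive_matching_def)
    moreover have "simple_graph (graph_union (circulant b D) (consecutive_matching b))"
      by (intro simple_graph_union simple_graph_circulant simple_graph_consecutive_matching)
    ultimately show ?thesis
      using 3 assms kb
      by (intro exI[of _ "graph_union (circulant b D) (consecutive_matching b)"])
        (auto simp: is_R_def intro!: bexI[of _ "b - 1"])
  qed
qed

lemma is_R_odd:
  assumes "is_R a b R" "odd (a * b)"
  obtains w where "w \<in> verts R" "degree R w = a - 1" "\<forall>v\<in>verts R - {w}. degree R v = a"
  using assms that unfolding is_R_def if_not_P[OF assms(2)] by blast

section \<open>The graphs \<open>KR\<close>\<close>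

lemma is_KR_exists:
  assumes "2 * t - 1 \<le> n" and "m \<le> t - 1" and "t \<ge> 2"
  shows "\<exists>G :: nat graph. is_KR t n m G"
proof -
  have "t - 1 < n - m" using assms by auto
  then obtain R where R: "is_R (t - 1) (n - m) R" "verts R = {0..<n - m}"
    using is_R_exists by blast
  let ?A = "{n - m..<n}"
  have A: "finite ?A" "card ?A = m" "?A \<inter> verts R = {}" using assms R by auto
  show ?thesis
  proof (cases "even ((t - 1) * (n - m)) \<or> m = 0")
    case True
    then show ?thesis unfolding is_KR_def using A R by metis
  next
    case False
    then obtain w where "w \<in> verts R" "degree R w = t - 1 - 1"
      using R by (auto simp: is_R_def)
    moreover have "t - 1 - 1 = t - 2" by simp
    moreover have "n - m \<in> ?A" using False assms by auto
    ultimately show ?thesis unfolding is_KR_def using A R False by metis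
  qed
qed

text \<open>The exceptional vertex of \<open>R\<close> has its degree raised to \<open>t - 1\<close> by the extra edge, unless
  the clique \<open>A\<close> is empty, when it keeps degree \<open>t - 2\<close>. Saturation and star counts depend only on
  the following data.\<close>

definition KR_degrees :: "nat \<Rightarrow> nat \<Rightarrow> nat \<Rightarrow> 'a graph \<Rightarrow> 'a set \<Rightarrow> bool" where
  "KR_degrees t n m G A \<longleftrightarrow> A \<subseteq> verts G \<and> card A = m \<and>
     (\<forall>u\<in>A. \<forall>v\<in>A. u \<noteq> v \<longrightarrow> {u, v} \<in> edges G) \<and>
     (if even ((t - 1) * (n - m))
      then (\<forall>v\<in>A. degree G v = m - 1) \<and> (\<forall>v\<in>verts G - A. degree G v = t - 1)
      else if m = 0
      then \<exists>w\<in>verts G. degree G w = t - 2 \<and> (\<forall>v\<in>verts G - {w}. degree G v = t - 1)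
      else (\<exists>x\<in>A. degree G x = m \<and> (\<forall>v\<in>A - {x}. degree G v = m - 1)) \<and>
        (\<forall>v\<in>verts G - A. degree G v = t - 1))"

lemma is_KR_degrees:
  assumes "is_KR t n m G" and "t \<ge> 2" and "m \<le> n"
  shows "simple_graph G" "card (verts G) = n" "\<exists>A. KR_degrees t n m G A"
proof -
  obtain A R where A: "finite A" "card A = m" and R: "is_R (t - 1) (n - m) R"
    and disj: "A \<inter> verts R = {}"
    and G: "if even ((t - 1) * (n - m)) \<or> m = 0
         then G = graph_union (complete_graph A) R
         else \<exists>w\<in>verts R. \<exists>x\<in>A. degree R w = t - 2 \<and>
                G = add_edge (graph_union (complete_graph A) R) w x"
    using assms(1) unfolding is_KR_def by auto
  define U where "U = graph_union (complete_graph A) R"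
  have sR: "simple_graph R" and cR: "card (verts R) = n - m" and fR: "finite (verts R)"
    using R by (auto simp: is_R_def simple_graph_def)
  have vU: "verts U = A \<union> verts R" by (simp add: U_def graph_union_def complete_graph_def)
  have sU: "simple_graph U"
    unfolding U_def using A sR by (simp add: simple_graph_union simple_graph_complete)
  have "edges (complete_graph A) \<inter> edges R = {}"
  proof (rule ccontr)
    assume "edges (complete_graph A) \<inter> edges R \<noteq> {}"
    then obtain e where "e \<subseteq> A" "e \<subseteq> verts R" "card e = 2"
      using sR by (auto simp: complete_graph_def simple_graph_def)
    then show False using disj by (metis Int_greatest card.empty subset_empty zero_neq_numeral)
  qed
  then have dU: "degree U v = degree (complete_graph A) v + degree R v" for v
    unfolding U_def using A sR by (simp add: degree_graph_union simple_graph_complete)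
  have dA: "degree U v = m - 1" if "v \<in> A" for v
    using that A disj dU[of v] degree_complete[of A v] degree_outside[OF sR, of v] by auto
  have dR: "degree U v = degree R v" if "v \<in> verts R" for v
  proof -
    have "v \<notin> verts (complete_graph A)" using that disj by (auto simp: complete_graph_def)
    then show ?thesis
      using dU[of v] degree_outside[OF simple_graph_complete[OF A(1)], of v] by simp
  qed
  have cU: "card (verts U) = n"
    unfolding vU using A fR disj cR assms(3) by (simp add: card_Un_disjoint)
  have clU: "{u, v} \<in> edges U" if "u \<in> A" "v \<in> A" "u \<noteq> v" for u v
    using that by (simp add: U_def graph_union_def complete_graph_def)
  have outside: "verts U - A = verts R" using disj vU by auto
  have "simple_graph G \<and> card (verts G) = n \<and> KR_degrees t n m G A"
  proof (cases "even ((t - 1) * (n - m)) \<or> m = 0")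
    case True
    then have GU: "G = U" using G by (simp add: U_def)
    have A0: "A = {}" if "m = 0" using that A by simp
    have "KR_degrees t n m U A"
    proof (cases "even ((t - 1) * (n - m))")
      case even: True
      then have "\<forall>v\<in>verts U - A. degree U v = t - 1"
        using R dR unfolding outside is_R_def by simp
      then show ?thesis
        unfolding KR_degrees_def if_P[OF even] using A dA clU vU by simp
    next
      case odd: False
      then have m0: "m = 0" using True by simp
      obtain w where w: "w \<in> verts R" "degree R w = t - 1 - 1"
          "\<forall>v\<in>verts R - {w}. degree R v = t - 1"
        using is_R_odd[OF R odd] by metis
      have "verts U = verts R" using vU A0 m0 by simp
      moreover have "t - 1 - 1 = t - 2" by simp
      ultimately have "\<exists>w\<in>verts U. degree U w = t - 2 \<and> (\<forall>v\<in>verts U - {w}. degree U v = t - 1)"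
        using dR w by auto
      then show ?thesis
        unfolding KR_degrees_def if_not_P[OF odd] if_P[OF m0] using A A0 m0 by simp
    qed
    then show ?thesis unfolding GU using sU cU by simp
  next
    case False
    then obtain w x where w: "w \<in> verts R" "degree R w = t - 2" and x: "x \<in> A"
      and GU: "G = add_edge U w x"
      using G by (auto simp: U_def)
    have "w \<noteq> x" using w x disj by auto
    have new: "{w, x} \<notin> edges U"
    proof
      assume "{w, x} \<in> edges U"
      then have "{w, x} \<subseteq> A \<or> {w, x} \<subseteq> verts R"
        using sR by (auto simp: U_def graph_union_def complete_graph_def simple_graph_def)
      then show False using w x disj by auto
    qed
    have sG: "simple_graph G"
      unfolding GU using sU w x vU \<open>w \<noteq> x\<close> by (intro simple_graph_add_edge) auto
    have vG: "verts G = verts U" by (simp add: GU add_edge_def)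
    have dG: "degree G v = degree U v + (if v = w \<or> v = x then 1 else 0)" for v
      unfolding GU by (rule degree_add_edge[OF sU new])
    obtain w' where w': "degree R w' = t - 1 - 1" "\<forall>v\<in>verts R - {w'}. degree R v = t - 1"
      using is_R_odd[OF R] False by metis
    have "t - 2 \<noteq> t - 1" using assms(2) by simp
    then have "w = w'" using w w' by (metis DiffI singletonD)
    have "degree G v = t - 1" if "v \<in> verts R" for v
    proof -
      have "v \<noteq> x" using that x disj by auto
      then show ?thesis
        using dG[of v] dR[OF that] w w' that \<open>w = w'\<close> assms(2) by (cases "v = w") auto
    qed
    then have "\<forall>v\<in>verts G - A. degree G v = t - 1" using vG outside by simp
    moreover have "degree G x = m" "\<forall>v\<in>A - {x}. degree G v = m - 1"
      using dG dA x w disj False by auto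
    then have "\<exists>x\<in>A. degree G x = m \<and> (\<forall>v\<in>A - {x}. degree G v = m - 1)" using x by blast
    moreover have "\<forall>u\<in>A. \<forall>v\<in>A. u \<noteq> v \<longrightarrow> {u, v} \<in> edges G"
      using clU by (simp add: GU add_edge_def)
    moreover have "A \<subseteq> verts G" using vG vU by blast
    moreover have "odd ((t - 1) * (n - m))" "m \<noteq> 0" using False by simp_all
    ultimately have "KR_degrees t n m G A"
      unfolding KR_degrees_def using A by presburger
    then show ?thesis using sG cU vG by simp
  qed
  then show "simple_graph G" "card (verts G) = n" "\<exists>A. KR_degrees t n m G A" by blast+
qed

lemma is_KR_saturated:
  assumes KR: "is_KR t n m G" and "t \<ge> 2" and "m \<le> n" and "m \<le> t - 1"
  shows "saturated (star t) G"
proof -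
  note G = is_KR_degrees(1)[OF assms(1-3)]
  obtain A where A: "KR_degrees t n m G A" using is_KR_degrees(3)[OF assms(1-3)] by blast
  \<comment> \<open>The clique is \<open>A\<close>, or a single vertex in the exceptional case.\<close>
  have "\<exists>K. (\<forall>v\<in>K. degree G v < t) \<and> (\<forall>v\<in>verts G - K. degree G v = t - 1) \<and>
      (\<forall>u\<in>K. \<forall>v\<in>K. u \<noteq> v \<longrightarrow> {u, v} \<in> edges G)"
  proof (cases "odd ((t - 1) * (n - m)) \<and> m = 0")
    case True
    then have "\<exists>w\<in>verts G. degree G w = t - 2 \<and> (\<forall>v\<in>verts G - {w}. degree G v = t - 1)"
      using A unfolding KR_degrees_def by meson
    then obtain w where "degree G w = t - 2" "\<forall>v\<in>verts G - {w}. degree G v = t - 1" by blast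
    moreover have "t - 2 < t" using assms(2) by simp
    ultimately show ?thesis by (intro exI[of _ "{w}"]) simp
  next
    case False
    have "degree G v \<le> m" if "v \<in> A" for v
    proof (cases "even ((t - 1) * (n - m))")
      case True
      then have "degree G v = m - 1" using A that unfolding KR_degrees_def by meson
      then show ?thesis by simp
    next
      case odd: False
      then obtain x where "degree G x = m" "\<forall>v\<in>A - {x}. degree G v = m - 1"
        using A False unfolding KR_degrees_def by meson
      then show ?thesis using that by (cases "v = x") simp_all
    qed
    then have "\<forall>v\<in>A. degree G v < t" using assms(2,4) by fastforce
    moreover have "\<forall>v\<in>verts G - A. degree G v = t - 1"
      using A False unfolding KR_degrees_def by meson
    moreover have "\<forall>u\<in>A. \<forall>v\<in>A. u \<noteq> v \<longrightarrow> {u, v} \<in> edges G"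
      using A unfolding KR_degrees_def by blast
    ultimately show ?thesis by blast
  qed
  then obtain K where K: "\<forall>v\<in>K. degree G v < t" "\<forall>v\<in>verts G - K. degree G v = t - 1"
    "\<forall>u\<in>K. \<forall>v\<in>K. u \<noteq> v \<longrightarrow> {u, v} \<in> edges G"
    by blast
  have "degree G v < t" if "v \<in> verts G" for v
    using K(1,2) that assms(2) by (cases "v \<in> K") simp_all
  moreover have "v \<in> K" if "v \<in> verts G" "degree G v < t - 1" for v
    using K(2) that by (metis DiffI less_irrefl)
  ultimately show ?thesis unfolding saturated_star_iff using G K(3) by blast
qed

text \<open>The value that \<open>\<Sum>v. degree G v choose r\<close> takes on \<open>KR\<^bsub>t,n\<^esub>(m)\<close>, unless \<open>m = 0\<close> and
  \<open>(t - 1)n\<close> is odd. The last term is the increase \<open>(m choose r) - (m - 1 choose r)\<close> caused by the extra edge at its end in the clique.\<close>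

definition KR_degree_sum :: "nat \<Rightarrow> nat \<Rightarrow> nat \<Rightarrow> nat \<Rightarrow> nat" where
  "KR_degree_sum t n m r =
     m * ((m - 1) choose r) + (n - m) * ((t - 1) choose r) +
     (if even ((t - 1) * (n - m)) then 0 else (m - 1) choose (r - 1))"

lemma choose_pascal_pred:
  "m \<ge> 1 \<Longrightarrow> r \<ge> 1 \<Longrightarrow> m choose r = ((m - 1) choose r) + ((m - 1) choose (r - 1))" for m r :: nat
  by (cases m; cases r) auto

lemma is_KR_degree_sum:
  assumes "is_KR t n m G" and "t \<ge> 2" and "m \<le> n" and r: "r \<ge> 1"
    and m: "even ((t - 1) * (n - m)) \<or> m \<ge> 1"
  shows "(\<Sum>v\<in>verts G. degree G v choose r) = KR_degree_sum t n m r"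
proof -
  obtain A where A: "KR_degrees t n m G A" using is_KR_degrees(3)[OF assms(1-3)] by blast
  have cl: "A \<subseteq> verts G" "card A = m" and out: "\<forall>v\<in>verts G - A. degree G v = t - 1"
    using A m unfolding KR_degrees_def by (blast, blast, metis not_one_le_zero)
  have fin: "finite (verts G)" "finite A"
    using is_KR_degrees(1)[OF assms(1-3)] finite_subset[OF cl(1)] by (auto simp: simple_graph_def)
  have "(\<Sum>v\<in>verts G. degree G v choose r) =
      (\<Sum>v\<in>verts G - A. degree G v choose r) + (\<Sum>v\<in>A. degree G v choose r)"
    using sum.subset_diff[OF cl(1) fin(1)] .
  also have "(\<Sum>v\<in>verts G - A. degree G v choose r) = (n - m) * ((t - 1) choose r)"
    using cl out fin is_KR_degrees(2)[OF assms(1-3)] by (simp add: card_Diff_subset)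
  also have "(\<Sum>v\<in>A. degree G v choose r) =
      m * ((m - 1) choose r) + (if even ((t - 1) * (n - m)) then 0 else (m - 1) choose (r - 1))"
  proof (cases "even ((t - 1) * (n - m))")
    case True
    then have "\<forall>v\<in>A. degree G v = m - 1" using A unfolding KR_degrees_def by meson
    then show ?thesis using cl True by simp
  next
    case False
    with m have m1: "m \<ge> 1" by simp
    then obtain x where x: "x \<in> A" "degree G x = m" "\<forall>v\<in>A - {x}. degree G v = m - 1"
      using A False unfolding KR_degrees_def by (metis not_one_le_zero)
    have "(\<Sum>v\<in>A. degree G v choose r) = (m choose r) + (m - 1) * ((m - 1) choose r)"
      using x cl fin by (simp add: sum.remove[of A x])
    also have "\<dots> = m * ((m - 1) choose r) + ((m - 1) choose (r - 1))"
      using choose_pascal_pred[OF m1 r] m1 by (cases m) auto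
    finally show ?thesis using False by simp
  qed
  finally show ?thesis by (simp add: KR_degree_sum_def)
qed

section \<open>The lower bound\<close>

text \<open>The number \<open>m\<close> is that of the vertices of degree below \<open>t - 1\<close>. They form a clique, whence the
  degrees dominate those of \<open>KR\<^bsub>t,n\<^esub>(m)\<close> without its extra edge; parity supplies the vertex of
  degree at least \<open>m\<close> that accounts for the extra edge.\<close>

lemma saturated_degree_sum_ge:
  assumes sat: "saturated (star t) G" and n: "card (verts G) = n" and r: "r \<ge> 1"
  obtains m where "m \<le> t - 1" "m \<le> n" "even ((t - 1) * (n - m)) \<or> m \<ge> 1"
    "KR_degree_sum t n m r \<le> (\<Sum>v\<in>verts G. degree G v choose r)"
proof -
  have G: "simple_graph G" and max: "\<forall>v\<in>verts G. degree G v < t"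
    and cl: "\<And>u v. u \<in> verts G \<Longrightarrow> v \<in> verts G \<Longrightarrow> u \<noteq> v \<Longrightarrow> degree G u < t - 1 \<Longrightarrow>
      degree G v < t - 1 \<Longrightarrow> {u, v} \<in> edges G"
    using sat unfolding saturated_star_iff by blast+
  define A where "A = {v \<in> verts G. degree G v < t - 1}"
  define m where "m = card A"
  have fin: "finite (verts G)" "finite A" and sub: "A \<subseteq> verts G"
    using G by (auto simp: A_def simple_graph_def)
  have low: "m - 1 \<le> degree G v" if "v \<in> A" for v
  proof -
    have "A - {v} \<subseteq> nbrs G v" using that cl by (auto simp: A_def nbrs_def)
    then have "card (A - {v}) \<le> card (nbrs G v)" by (rule card_mono[OF finite_nbrs[OF G]])
    then show ?thesis using that fin by (simp add: m_def degree_eq_card_nbrs[OF G])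
  qed
  have top: "degree G v = t - 1" if "v \<in> verts G - A" for v
    using that max by (force simp: A_def)
  have "m \<le> t - 1"
  proof (cases "A = {}")
    case False
    then obtain v where "v \<in> A" by blast
    then show ?thesis using low[of v] by (auto simp: A_def)
  qed (simp add: m_def)
  have "m \<le> n" using card_mono[OF fin(1) sub] by (simp add: m_def n)
  have split: "(\<Sum>v\<in>verts G. f (degree G v)) = (\<Sum>v\<in>A. f (degree G v)) + (n - m) * f (t - 1)"
    for f :: "nat \<Rightarrow> nat"
  proof -
    have "(\<Sum>v\<in>verts G - A. f (degree G v)) = (n - m) * f (t - 1)"
      using top fin sub n by (simp add: card_Diff_subset m_def)
    then show ?thesis using sum.subset_diff[OF sub fin(1), of "\<lambda>v. f (degree G v)"] by simp
  qed
  have base: "(\<Sum>v\<in>B. (m - 1) choose r) \<le> (\<Sum>v\<in>B. degree G v choose r)" if "B \<subseteq> A" for B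
    using low that by (intro sum_mono binomial_right_mono) auto
  show ?thesis
  proof (cases "even ((t - 1) * (n - m))")
    case True
    have "KR_degree_sum t n m r \<le> (\<Sum>v\<in>verts G. degree G v choose r)"
      using base[of A] True by (simp add: KR_degree_sum_def split[of "\<lambda>d. d choose r"] m_def)
    then show ?thesis using that[of m] True \<open>m \<le> t - 1\<close> \<open>m \<le> n\<close> by blast
  next
    case False
    \<comment> \<open>Otherwise the degree sum is the even number \<open>m(m - 1)\<close> plus an odd one. This includes
      the case \<open>A = {}\<close>.\<close>
    have "\<exists>x\<in>A. degree G x \<noteq> m - 1"
    proof (rule ccontr)
      assume "\<not> ?thesis"
      then have "(\<Sum>v\<in>A. degree G v) = m * (m - 1)" by (simp add: m_def)
      then have "m * (m - 1) + (n - m) * (t - 1) = 2 * card (edges G)"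
        using split[of "\<lambda>d. d"] handshake[OF G] by simp
      moreover have "even (m * (m - 1))" by (cases m) auto
      ultimately have "even ((n - m) * (t - 1))" by (metis dvd_triv_left even_add)
      then show False using False by (simp add: mult.commute)
    qed
    then obtain x where x: "x \<in> A" "degree G x \<noteq> m - 1" by blast
    then have m1: "m \<ge> 1" using fin by (auto simp: m_def Suc_le_eq card_gt_0_iff)
    have "degree G x \<ge> m" using low[OF x(1)] x(2) by simp
    then have "m choose r \<le> degree G x choose r" by (rule binomial_right_mono)
    moreover have "(m - 1) * ((m - 1) choose r) \<le> (\<Sum>v\<in>A - {x}. degree G v choose r)"
      using base[of "A - {x}"] x fin by (simp add: m_def)
    moreover have "(\<Sum>v\<in>A. degree G v choose r) =
        (degree G x choose r) + (\<Sum>v\<in>A - {x}. degree G v choose r)"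
      using fin(2) x(1) by (rule sum.remove)
    moreover have "m * ((m - 1) choose r) = ((m - 1) choose r) + (m - 1) * ((m - 1) choose r)"
      using m1 by (cases m) auto
    ultimately have "KR_degree_sum t n m r \<le> (\<Sum>v\<in>verts G. degree G v choose r)"
      using choose_pascal_pred[OF m1 r] False
      by (simp add: KR_degree_sum_def split[of "\<lambda>d. d choose r"])
    then show ?thesis using that[of m] m1 \<open>m \<le> t - 1\<close> \<open>m \<le> n\<close> by blast
  qed
qed

section \<open>The saturation number\<close>

theorem theorem3p1:
  fixes n t r :: nat
  assumes "t \<ge> 2" and "r < t" and "n \<ge> 2 * t - 1"
  shows "(\<forall>m\<le>t - 1. \<exists>G :: nat graph. is_KR t n m G) \<and>
    (\<forall>KR :: nat \<Rightarrow> nat graph. (\<forall>m\<le>t - 1. is_KR t n m (KR m)) \<longrightarrow>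
       gen_sat (star r) n (star t) = (MIN m\<in>{0..t - 1}. star_count r (KR m))) \<and>
    (\<forall>m\<le>t - 1. \<forall>G :: nat graph.
       is_KR t n m G \<and> r \<ge> 1 \<and> (even ((t - 1) * (n - m)) \<or> m \<ge> 1) \<longrightarrow>
       (if r = 1 then 2 else 1) * star_count r G =
         (if even ((t - 1) * (n - m))
          then m * ((m - 1) choose r) + (n - m) * ((t - 1) choose r)
          else m * ((m - 1) choose r) + (n - m) * ((t - 1) choose r) + ((m - 1) choose (r - 1))))"
proof -
  have le_n: "m \<le> n" if "m \<le> t - 1" for m using that assms by simp
  have sum_KR: "(if r = 1 then 2 else 1) * star_count r G = KR_degree_sum t n m r"
    if "is_KR t n m G" "m \<le> t - 1" "r \<ge> 1" "even ((t - 1) * (n - m)) \<or> m \<ge> 1"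
    for m and G :: "nat graph"
  proof -
    have "simple_graph G" using is_KR_degrees(1)[OF that(1) assms(1) le_n[OF that(2)]] .
    then show ?thesis
      using star_count_degree_sum[OF _ that(3)]
        is_KR_degree_sum[OF that(1) assms(1) le_n[OF that(2)] that(3,4)] by metis
  qed
  have sat: "gen_sat (star r) n (star t) = (MIN m\<in>{0..t - 1}. star_count r (KR m))"
    if KR: "\<forall>m\<le>t - 1. is_KR t n m (KR m)" for KR :: "nat \<Rightarrow> nat graph"
    unfolding gen_sat_def
  proof (rule Least_equality)
    let ?min = "MIN m\<in>{0..t - 1}. star_count r (KR m)"
    have "?min \<in> (\<lambda>m. star_count r (KR m)) ` {0..t - 1}" by (rule Min_in) auto
    then obtain m where "?min = star_count r (KR m)" "m \<in> {0..t - 1}" by (rule imageE)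
    then have m: "m \<le> t - 1" "?min = star_count r (KR m)" by simp_all
    then have "is_KR t n m (KR m)" using KR by blast
    then have "saturated (star t) (KR m)" "card (verts (KR m)) = n"
      using is_KR_saturated[OF _ assms(1) le_n[OF m(1)] m(1)]
        is_KR_degrees(2)[OF _ assms(1) le_n[OF m(1)]] by blast+
    then show "\<exists>G :: nat graph. saturated (star t) G \<and> card (verts G) = n \<and>
        card (copies (star r) G) = ?min"
      using m(2) unfolding star_count_def by metis
  next
    fix k
    assume "\<exists>G :: nat graph. saturated (star t) G \<and> card (verts G) = n \<and>
        card (copies (star r) G) = k"
    then obtain G :: "nat graph" where G: "saturated (star t) G" "card (verts G) = n"
      and k: "star_count r G = k" by (auto simp: star_count_def)
    have simple: "simple_graph G" using G(1) by (simp add: saturated_def)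
    have "\<exists>m\<le>t - 1. star_count r (KR m) \<le> k"
    proof (cases "r = 0")
      case True
      have "is_KR t n 0 (KR 0)" using KR by simp
      then have "simple_graph (KR 0)" "card (verts (KR 0)) = n"
        using is_KR_degrees(1,2)[of t n 0 "KR 0"] assms(1) by simp_all
      then show ?thesis using True k G(2) star_count_0 simple by (metis le0 order_refl)
    next
      case False
      then have r: "r \<ge> 1" by simp
      obtain m where m: "m \<le> t - 1" "even ((t - 1) * (n - m)) \<or> m \<ge> 1"
        and ge: "KR_degree_sum t n m r \<le> (\<Sum>v\<in>verts G. degree G v choose r)"
        using saturated_degree_sum_ge[OF G r] by metis
      have "is_KR t n m (KR m)" using KR m(1) by blast
      from sum_KR[OF this m(1) r m(2)] ge star_count_degree_sum[OF simple r]
      have "star_count r (KR m) \<le> star_count r G" by (auto split: if_splits)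
      then show ?thesis using m(1) k by blast
    qed
    then obtain m where "m \<le> t - 1" "star_count r (KR m) \<le> k" by blast
    then show "(MIN m\<in>{0..t - 1}. star_count r (KR m)) \<le> k"
      by (intro order_trans[OF Min_le]) auto
  qed
  show ?thesis
  proof (intro conjI allI impI)
    show "\<exists>G :: nat graph. is_KR t n m G" if "m \<le> t - 1" for m
      using is_KR_exists[OF assms(3) that assms(1)] .
  next
    show "gen_sat (star r) n (star t) = (MIN m\<in>{0..t - 1}. star_count r (KR m))"
      if "\<forall>m\<le>t - 1. is_KR t n m (KR m)" for KR :: "nat \<Rightarrow> nat graph"
      using sat[OF that] .
  next
    fix m and G :: "nat graph"
    assume "m \<le> t - 1"
      and "is_KR t n m G \<and> r \<ge> 1 \<and> (even ((t - 1) * (n - m)) \<or> m \<ge> 1)"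
    then show "(if r = 1 then 2 else 1) * star_count r G =
         (if even ((t - 1) * (n - m))
          then m * ((m - 1) choose r) + (n - m) * ((t - 1) choose r)
          else m * ((m - 1) choose r) + (n - m) * ((t - 1) choose r) + ((m - 1) choose (r - 1)))"
      using sum_KR[of m G] by (simp add: KR_degree_sum_def)
  qed
qed

end
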